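(* Let $a=(a_1,\dots,a_n)$ and $b=(b_1,\dots,b_m)$ be probability vectors with positive entries and let $C=(c_{ij})\in\mathbb{R}_{\ge 0}^{n\times m}$. For every $\varepsilon>0$ and $\lambda>0$, the entropic partial optimal transport problem $$\mathrm{OT}_{\varepsilon,\lambda}(a,b;C)=\min_{\Gamma\in\Pi(\widetilde a,\widetilde b)}\left\{\sum_{i=1}^{n+1}\sum_{j=1}^{m+1}\widetilde c^{\lambda}_{ij}\Gamma_{ij}+\varepsilon E(\Gamma)+2\lambda\right\}$$ admits a unique minimizer.
   Context: For nonnegative vectors $r,s$ of equal total mass, $\Pi(r,s)$ is the set of nonnegative matrices with row sums $r$ and column sums $s$. The extended marginals are $\widetilde a=(a_1,\dots,a_n,1)$ and $\widetilde b=(b_1,\dots,b_m,1)$. The extended cost matrix $\widetilde C^{\lambda}\in\mathbb{R}^{(n+1)\times(m+1)}$ has entries $\widetilde c^{\lambda}_{ij}=c_{ij}-2\lambda$ if $1\le i\le n$ and $1\le j\le m$, and $\widetilde c^{\lambda}_{ij}=0$ otherwise. For a nonnegative matrix $A$, $E(A)=\sum_{i,j}A_{ij}(\log A_{ij}-1)$, with the convention $0\log 0=0$. *)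

theory Defs
  imports "HOL-Analysis.Analysis"
begin

text \<open>
  Vectors of length \<open>n\<close> are indexed by a finite type \<open>'n\<close>, and \<open>n \<times> m\<close> matrices have type
  \<open>real ^ 'm ^ 'n\<close>, so that \<open>A $ i $ j\<close> is the entry in row \<open>i\<close> and column \<open>j\<close>. The extended index set
  \<open>{1, \<dots>, n + 1}\<close> is \<open>'n option\<close>: \<open>Some i\<close> is an original index and \<open>None\<close> is the additional
  index \<open>n + 1\<close>.
\<close>

definition couplings :: "real ^ 'r::finite \<Rightarrow> real ^ 's::finite \<Rightarrow> (real ^ 's ^ 'r) set" where
  "couplings r s =
     {G. (\<forall>i j. 0 \<le> G $ i $ j) \<and>
         (\<forall>i. (\<Sum>j\<in>UNIV. G $ i $ j) = r $ i) \<and>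
         (\<forall>j. (\<Sum>i\<in>UNIV. G $ i $ j) = s $ j)}"

definition ext_marginal :: "real ^ 'n::finite \<Rightarrow> real ^ 'n option" where
  "ext_marginal a = (\<chi> i. case i of Some k \<Rightarrow> a $ k | None \<Rightarrow> 1)"

definition ext_cost ::
  "real \<Rightarrow> real ^ 'm::finite ^ 'n::finite \<Rightarrow> real ^ 'm option ^ 'n option" where
  "ext_cost lam C =
     (\<chi> i j. case (i, j) of (Some k, Some l) \<Rightarrow> C $ k $ l - 2 * lam | _ \<Rightarrow> 0)"

text \<open>A zero entry contributes \<open>0 * (ln 0 - 1) = 0\<close>, as the convention \<open>0 log 0 = 0\<close> requires.\<close>

definition entropy_fun :: "real ^ 's::finite ^ 'r::finite \<Rightarrow> real" where
  "entropy_fun A = (\<Sum>i\<in>UNIV. \<Sum>j\<in>UNIV. A $ i $ j * (ln (A $ i $ j) - 1))"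

definition epot_objective ::
  "real \<Rightarrow> real \<Rightarrow> real ^ 'm::finite ^ 'n::finite \<Rightarrow> real ^ 'm option ^ 'n option \<Rightarrow> real" where
  "epot_objective \<epsilon> lam C \<Gamma> =
     (\<Sum>i\<in>UNIV. \<Sum>j\<in>UNIV. ext_cost lam C $ i $ j * \<Gamma> $ i $ j) + \<epsilon> * entropy_fun \<Gamma> + 2 * lam"

end

theory Submission
  imports Defs "HOL-Real_Asymp.Real_Asymp"
begin

text \<open>
  The set of couplings is compact and convex, and it contains the normalized product of the
  marginals. The objective is continuous on it because \<open>x ln x\<close> extends continuously to \<open>0\<close>, so a
  minimizer exists. The entropy is strictly convex, so the midpoint of two distinct minimizers would
  have a smaller value.
\<close>

lemma continuous_on_entropy_term: "continuous_on {0..} (\<lambda>x::real. x * (ln x - 1))"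
  unfolding continuous_on_eq_continuous_within
proof
  fix x :: real
  assume "x \<in> {0..}"
  then consider "x = 0" | "0 < x" by fastforce
  then show "continuous (at x within {0..}) (\<lambda>x. x * (ln x - 1))"
  proof cases
    case 1
    \<comment> \<open>Only \<open>0\<close> is delicate: \<open>ln\<close> is unbounded there, but
      \<open>x * ln x\<close> tends to \<open>0\<close>, which is also the value at \<open>0\<close>
      because the factor \<open>x\<close> vanishes.\<close>
    have "((\<lambda>x::real. x * (ln x - 1)) \<longlongrightarrow> 0) (at_right 0)" by real_asymp
    then have "((\<lambda>x::real. x * (ln x - 1)) \<longlongrightarrow> 0) (at 0 within {0..})"
      by (simp add: at_within_Ici_at_right)
    then show ?thesis using 1 by (simp add: continuous_within)
  next
    case 2
    then have "isCont (\<lambda>x. x * (ln x - 1)) x" by (intro continuous_intros) auto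
    then show ?thesis by (rule continuous_at_imp_continuous_at_within)
  qed
qed

text \<open>With \<open>\<phi> x = x * (ln x - 1)\<close> one has \<open>\<phi>' m = ln m\<close>,
  so the left side is the tangent to \<open>\<phi>\<close> at \<open>m\<close>. For
  \<open>x > 0\<close> the gap comes from \<open>ln t < t - 1\<close> at \<open>t = m / x\<close>,
  strict because \<open>t\<close> differs from \<open>1\<close>; for \<open>x = 0\<close> the claim
  is \<open>- m < 0\<close>.\<close>

lemma entropy_term_gt_tangent:
  fixes x m :: real
  assumes "0 \<le> x" "0 < m" "x \<noteq> m"
  shows "x * ln m - m < x * (ln x - 1)"
proof (cases "x = 0")
  case False
  with assms have "0 < x" by simp
  have "ln (m / x) < m / x - 1"
    using ln_le_minus_one[of "m / x"] ln_eq_minus_one[of "m / x"] \<open>0 < x\<close> assms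
    by (auto simp: less_le)
  then have "x * (ln m - ln x) < x * (m / x - 1)"
    using \<open>0 < x\<close> assms by (simp add: ln_div)
  also have "\<dots> = m - x" using \<open>0 < x\<close> by (simp add: field_simps)
  finally show ?thesis by (simp add: algebra_simps)
qed (use assms in simp)

text \<open>Both endpoints lie strictly above the tangent at the midpoint. Adding the two
  inequalities cancels the slope, since \<open>x - m\<close> and \<open>y - m\<close> are
  opposite.\<close>

lemma entropy_term_midpoint_less:
  fixes x y :: real
  assumes "0 \<le> x" "0 \<le> y" "x \<noteq> y"
  shows "(x + y) / 2 * (ln ((x + y) / 2) - 1) < (x * (ln x - 1) + y * (ln y - 1)) / 2"
proof -
  define m where "m = (x + y) / 2"
  \<comment> \<open>Distinct nonnegative numbers cannot both be \<open>0\<close>, so the midpoint is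
    positive even if one of them vanishes, and the tangent there exists.\<close>
  have "0 < m" "x \<noteq> m" "y \<noteq> m" "y = 2 * m - x" using assms by (auto simp: m_def field_simps)
  then have "x * ln m - m + (y * ln m - m) < x * (ln x - 1) + y * (ln y - 1)"
    using assms by (intro add_strict_mono entropy_term_gt_tangent) auto
  moreover have "x * ln m - m + (y * ln m - m) = 2 * (m * (ln m - 1))"
    unfolding \<open>y = 2 * m - x\<close> by (simp add: algebra_simps)
  ultimately show ?thesis unfolding m_def[symmetric] by simp
qed

lemma entropy_term_midpoint_le:
  fixes x y :: real
  assumes "0 \<le> x" "0 \<le> y"
  shows "(x + y) / 2 * (ln ((x + y) / 2) - 1) \<le> (x * (ln x - 1) + y * (ln y - 1)) / 2"
  using entropy_term_midpoint_less[OF assms] by (cases "x = y") auto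

text \<open>The entropy is separable: every entry satisfies the weak inequality, and one entry where
  the matrices differ makes it strict, first in its row sum and then in the total.\<close>

lemma entropy_fun_midpoint_less:
  fixes G H :: "real ^ 's::finite ^ 'r::finite"
  assumes "\<And>i j. 0 \<le> G $ i $ j" "\<And>i j. 0 \<le> H $ i $ j" "G \<noteq> H"
  shows "entropy_fun ((1 / 2) *\<^sub>R (G + H)) < (entropy_fun G + entropy_fun H) / 2"
proof -
  let ?\<phi> = "\<lambda>x::real. x * (ln x - 1)"
  obtain k l where kl: "G $ k $ l \<noteq> H $ k $ l"
    using \<open>G \<noteq> H\<close> by (auto simp: vec_eq_iff)
  have le: "?\<phi> ((G $ i $ j + H $ i $ j) / 2) \<le> (?\<phi> (G $ i $ j) + ?\<phi> (H $ i $ j)) / 2" for i j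
    by (intro entropy_term_midpoint_le assms)
  have "(\<Sum>j\<in>UNIV. ?\<phi> ((G $ k $ j + H $ k $ j) / 2))
      < (\<Sum>j\<in>UNIV. (?\<phi> (G $ k $ j) + ?\<phi> (H $ k $ j)) / 2)"
    using le entropy_term_midpoint_less[OF assms(1,2) kl]
    by (intro sum_strict_mono_ex1) auto
  then have "(\<Sum>i\<in>UNIV. \<Sum>j\<in>UNIV. ?\<phi> ((G $ i $ j + H $ i $ j) / 2))
      < (\<Sum>i\<in>UNIV. \<Sum>j\<in>UNIV. (?\<phi> (G $ i $ j) + ?\<phi> (H $ i $ j)) / 2)"
    using le by (intro sum_strict_mono_ex1) (auto intro: sum_mono)
  then show ?thesis
    by (simp add: entropy_fun_def sum.distrib sum_divide_distrib[symmetric])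
qed

lemma compact_couplings: "compact (couplings r s)"
proof -
  have "G $ i $ j \<le> r $ i" if "G \<in> couplings r s" for G i j
  proof -
    have "G $ i $ j \<le> (\<Sum>j\<in>UNIV. G $ i $ j)"
      using that by (intro member_le_sum) (auto simp: couplings_def)
    then show ?thesis using that by (simp add: couplings_def)
  qed
  \<comment> \<open>The interval is taken in the entrywise order, so it is a compact box.\<close>
  then have "couplings r s \<subseteq> {0..(\<chi> i j. r $ i)}"
    by (auto simp: less_eq_vec_def couplings_def)
  then have "bounded (couplings r s)"
    by (rule bounded_subset[OF compact_imp_bounded[OF compact_interval]])
  moreover have "closed (couplings r s)"
    unfolding couplings_def
    by (intro closed_Collect_conj closed_Collect_all closed_Collect_le closed_Collect_eq
        continuous_intros)
  ultimately show ?thesis by (simp add: compact_eq_bounded_closed)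
qed

lemma convex_couplings: "convex (couplings r s)"
  by (rule convexI)
    (auto simp: couplings_def sum.distrib sum_distrib_left[symmetric] distrib_right[symmetric])

lemma couplings_nonempty:
  assumes "\<And>i. 0 \<le> r $ i" "\<And>j. 0 \<le> s $ j"
    and "(\<Sum>i\<in>UNIV. r $ i) = t" "(\<Sum>j\<in>UNIV. s $ j) = t" "0 < t"
  shows "couplings r s \<noteq> {}"
proof -
  \<comment> \<open>Row \<open>i\<close> of the product sums to \<open>r $ i * t\<close>, and
    columns behave likewise; dividing by the common mass \<open>t\<close> restores the
    marginals.\<close>
  have "(\<chi> i j. r $ i * s $ j / t) \<in> couplings r s"
    using assms
    by (simp add: couplings_def sum_divide_distrib[symmetric] sum_distrib_left[symmetric]
        sum_distrib_right[symmetric])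
  then show ?thesis by blast
qed

lemma ext_marginal_nonneg:
  assumes "\<And>i. 0 \<le> a $ i"
  shows "0 \<le> ext_marginal a $ i"
  using assms by (simp add: ext_marginal_def split: option.split)

lemma sum_ext_marginal: "(\<Sum>i\<in>UNIV. ext_marginal a $ i) = 1 + (\<Sum>i\<in>UNIV. a $ i)"
  by (simp add: UNIV_option_conv sum.reindex ext_marginal_def)

lemma continuous_on_epot_objective:
  "continuous_on (couplings r s) (epot_objective \<epsilon> lam C)"
proof -
  have "continuous_on (couplings r s) (\<lambda>G. G $ i $ j * (ln (G $ i $ j) - 1))" for i j
    \<comment> \<open>Couplings have nonnegative entries, so each entry map lands in
      \<open>{0..}\<close>.\<close>
    by (rule continuous_on_compose2[OF continuous_on_entropy_term])
      (auto intro!: continuous_intros simp: couplings_def)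
  then have "continuous_on (couplings r s) entropy_fun"
    unfolding entropy_fun_def by (intro continuous_on_sum)
  then show ?thesis
    unfolding epot_objective_def by (intro continuous_intros)
qed

text \<open>The cost term is linear and \<open>2 * lam\<close> is constant, so both agree with their
  average at the midpoint; strictness comes from the entropy, scaled by
  \<open>\<epsilon> > 0\<close>.\<close>

lemma epot_objective_midpoint_less:
  assumes "0 < \<epsilon>" "G \<in> couplings r s" "H \<in> couplings r s" "G \<noteq> H"
  shows "epot_objective \<epsilon> lam C ((1 / 2) *\<^sub>R (G + H))
    < (epot_objective \<epsilon> lam C G + epot_objective \<epsilon> lam C H) / 2"
proof -
  have "\<epsilon> * entropy_fun ((1 / 2) *\<^sub>R (G + H)) < \<epsilon> * ((entropy_fun G + entropy_fun H) / 2)"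
    using assms by (intro mult_strict_left_mono entropy_fun_midpoint_less)
      (auto simp: couplings_def)
  then show ?thesis
    by (simp add: epot_objective_def sum.distrib sum_divide_distrib[symmetric] algebra_simps
        add_divide_distrib)
qed

theorem proposition3p2:
  fixes a :: "real ^ 'n::finite" and b :: "real ^ 'm::finite"
    and C :: "real ^ 'm ^ 'n" and \<epsilon> lam :: real
  assumes "\<And>i. 0 < a $ i" and "(\<Sum>i\<in>UNIV. a $ i) = 1"
    and "\<And>j. 0 < b $ j" and "(\<Sum>j\<in>UNIV. b $ j) = 1"
    and "\<And>i j. 0 \<le> C $ i $ j"
    and "0 < \<epsilon>" and "0 < lam"
  shows "\<exists>!\<Gamma>. is_arg_min (epot_objective \<epsilon> lam C)
                (\<lambda>\<Gamma>. \<Gamma> \<in> couplings (ext_marginal a) (ext_marginal b)) \<Gamma>"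
proof -
  let ?K = "couplings (ext_marginal a) (ext_marginal b)" and ?f = "epot_objective \<epsilon> lam C"
  have "?K \<noteq> {}"
    \<comment> \<open>The common mass is \<open>2\<close>: a probability vector plus the additional
      entry \<open>1\<close>.\<close>
    using assms by (intro couplings_nonempty[where t = 2] ext_marginal_nonneg)
      (auto simp: sum_ext_marginal less_imp_le)
  then obtain G where "G \<in> ?K" "\<forall>H\<in>?K. ?f G \<le> ?f H"
    using continuous_attains_inf[OF compact_couplings _ continuous_on_epot_objective] by blast
  then have "is_arg_min ?f (\<lambda>\<Gamma>. \<Gamma> \<in> ?K) G"
    by (simp add: is_arg_min_linorder)
  moreover have "G = H"
    if "is_arg_min ?f (\<lambda>\<Gamma>. \<Gamma> \<in> ?K) G" "is_arg_min ?f (\<lambda>\<Gamma>. \<Gamma> \<in> ?K) H" for G H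
  proof (rule ccontr)
    assume "G \<noteq> H"
    have GH: "G \<in> ?K" "H \<in> ?K" "?f G = ?f H" and min: "\<And>M. M \<in> ?K \<Longrightarrow> ?f G \<le> ?f M"
      using that by (auto simp: is_arg_min_linorder intro: antisym)
    have "(1 / 2) *\<^sub>R (G + H) \<in> ?K"
      using convexD[OF convex_couplings GH(1,2), of "1 / 2" "1 / 2"]
      by (simp add: scaleR_add_right)
    then have "?f G \<le> ?f ((1 / 2) *\<^sub>R (G + H))" by (rule min)
    also have "\<dots> < (?f G + ?f H) / 2"
      by (rule epot_objective_midpoint_less[OF \<open>0 < \<epsilon>\<close> GH(1,2) \<open>G \<noteq> H\<close>])
    also have "\<dots> = ?f G" using GH(3) by simp
    finally show False by simp
  qed
  ultimately show ?thesis by blast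
qed

end
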